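(* Let $n\geq 1$ be an integer and let $f\in L^\infty(\mathbb{C})$ (with respect to Lebesgue measure). The following conditions are equivalent: (i) $B_n f=f$; (ii) $f$ is harmonic on $\mathbb{C}$; (iii) $f$ is constant.
   Context: $\lambda$ is the Lebesgue area measure on $\mathbb{C}\simeq\mathbb{R}^2$ and $d\mu(z)=\frac{e^{-|z|^2}}{\pi}\,d\lambda(z)$ is the Gaussian probability measure; $\langle f,g\rangle=\int_{\mathbb{C}} f\overline{g}\,d\mu$. The generalized Laguerre polynomials are $L^\beta_k(x)=\sum_{j=0}^{k}\binom{k+\beta}{k-j}\frac{(-x)^j}{j!}$. For $n\geq1$, the $n$-analytic Fock space $F^2_n(\mathbb{C})$ is the closed subspace of $L^2(\mathbb{C},d\mu)$ of functions $f$ with $\partial^n f/\partial\overline{z}^n=0$ on $\mathbb{C}$; its reproducing kernel is $K_n(z,w)=L^1_{n-1}(|z-w|^2)e^{z\overline{w}}$. The normalized kernel is $k^n_z(w)=K_n(w,z)/\sqrt{K_n(z,z)}$. The Berezin transform of $f$ is $B_nf(z)=\langle f k_z^n,k_z^n\rangle=\int_{\mathbb{C}} f\,|k^n_z|^2\,d\mu$, $z\in\mathbb{C}$. Functions are complex-valued and elements of $L^\infty$ are identified when equal almost everywhere (so "harmonic" and "constant" mean coinciding almost everywhere with a harmonic, respectively constant, function). *)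

theory Defs
  imports "HOL-Analysis.Analysis"
begin

(* The base measure is lebesgue (the completion of lborel), so that every Lebesgue measurable
   f is integrated properly, not only the Borel measurable representatives. *)
definition gauss :: "complex measure" where
  "gauss = density lebesgue (\<lambda>z. ennreal (exp (- (cmod z)\<^sup>2) / pi))"

definition gauss_inner :: "(complex \<Rightarrow> complex) \<Rightarrow> (complex \<Rightarrow> complex) \<Rightarrow> complex" where
  "gauss_inner f g = (LINT z|gauss. f z * cnj (g z))"

definition laguerre :: "real \<Rightarrow> nat \<Rightarrow> real \<Rightarrow> real" where
  "laguerre \<beta> k x = (\<Sum>j\<le>k. ((real k + \<beta>) gchoose (k - j)) * (- x) ^ j / fact j)"

(* The reproducing kernel of the n-analytic Fock space, n \<ge> 1, in closed form. *)
definition fock_kernel :: "nat \<Rightarrow> complex \<Rightarrow> complex \<Rightarrow> complex" where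
  "fock_kernel n z w = of_real (laguerre 1 (n - 1) ((cmod (z - w))\<^sup>2)) * exp (z * cnj w)"

(* fock_kernel n z z is the positive real n * exp ((cmod z)\<^sup>2), so csqrt is the usual root. *)
definition normalized_kernel :: "nat \<Rightarrow> complex \<Rightarrow> complex \<Rightarrow> complex" where
  "normalized_kernel n z w = fock_kernel n w z / csqrt (fock_kernel n z z)"

definition berezin :: "nat \<Rightarrow> (complex \<Rightarrow> complex) \<Rightarrow> complex \<Rightarrow> complex" where
  "berezin n f z = gauss_inner (\<lambda>w. f w * normalized_kernel n z w) (normalized_kernel n z)"

definition L_infty :: "(complex \<Rightarrow> complex) set" where
  "L_infty = {f \<in> borel_measurable lebesgue. \<exists>C. AE z in lebesgue. cmod (f z) \<le> C}"

definition partial_deriv ::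
    "'a::euclidean_space \<Rightarrow> ('a \<Rightarrow> 'b::real_normed_vector) \<Rightarrow> 'a \<Rightarrow> 'b" where
  "partial_deriv b f z = frechet_derivative f (at z) b"

definition C1_on :: "'a::euclidean_space set \<Rightarrow> ('a \<Rightarrow> 'b::real_normed_vector) \<Rightarrow> bool" where
  "C1_on S f \<longleftrightarrow> f differentiable_on S \<and> (\<forall>b\<in>Basis. continuous_on S (partial_deriv b f))"

definition C2_on :: "'a::euclidean_space set \<Rightarrow> ('a \<Rightarrow> 'b::real_normed_vector) \<Rightarrow> bool" where
  "C2_on S f \<longleftrightarrow> C1_on S f \<and> (\<forall>b\<in>Basis. C1_on S (partial_deriv b f))"

definition laplacian :: "('a::euclidean_space \<Rightarrow> 'b::real_normed_vector) \<Rightarrow> 'a \<Rightarrow> 'b" where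
  "laplacian f z = (\<Sum>b\<in>Basis. partial_deriv b (partial_deriv b f) z)"

definition harmonic_on ::
    "('a::euclidean_space \<Rightarrow> 'b::real_normed_vector) \<Rightarrow> 'a set \<Rightarrow> bool"
    (infix "harmonic'_on" 50) where
  "f harmonic_on S \<longleftrightarrow> open S \<and> C2_on S f \<and> (\<forall>z\<in>S. laplacian f z = 0)"

end

theory Submission
  imports Defs "HOL-Probability.Distributions" "HOL-Complex_Analysis.Complex_Analysis"
begin

text \<open>
  The Berezin transform is convolution with \<open>p u = L\<^sup>1\<^bsub>n-1\<^esub>(|u|\<^sup>2)\<^sup>2 exp (-|u|\<^sup>2) / (n \<pi>)\<close>, a probability
  density that is positive outside finitely many circles. A bounded fixed point is then constant by a
  Choquet--Deny argument: near a point where an increment \<open>F (x + a) - F x\<close> almost attains its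
  supremum \<open>M\<close>, averaging forces the increments at all translates to be almost \<open>M\<close>, and summing them
  along a progression contradicts boundedness unless \<open>M \<le> 0\<close>. A bounded real harmonic function \<open>u\<close> is
  constant because \<open>u\<^sub>x - \<i> u\<^sub>y\<close> is entire, and its primitive \<open>G\<close> has \<open>Re G = u + c\<close>, so that \<open>exp G\<close>
  is a bounded entire function.
\<close>

section \<open>Bounded fixed points of convolution\<close>

lemma lborel_translation:
  fixes f :: "'a::euclidean_space \<Rightarrow> 'b::{banach, second_countable_topology}"
  assumes "f \<in> borel_measurable borel"
  shows "integrable lborel (\<lambda>x. f (x + c)) \<longleftrightarrow> integrable lborel f"
    and "(LINT x|lborel. f (x + c)) = integral\<^sup>L lborel f"
proof -
  have d: "distr lborel lborel (\<lambda>x. x + c) = lborel"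
    using lborel_distr_plus[of c] by (simp add: add.commute cong: distr_cong)
  have m: "(\<lambda>x. x + c) \<in> lborel \<rightarrow>\<^sub>M (lborel :: 'a measure)" and f: "f \<in> borel_measurable lborel"
    using assms by simp_all
  show "integrable lborel (\<lambda>x. f (x + c)) \<longleftrightarrow> integrable lborel f"
    using integrable_distr_eq[OF m f] by (simp add: d)
  show "(LINT x|lborel. f (x + c)) = integral\<^sup>L lborel f"
    using integral_distr[OF m f] by (simp add: d)
qed

text \<open>The Choquet-Deny argument sees the kernel only as a probability density. Positivity
  almost everywhere makes every translate of \<open>p\<close> dominated by a large multiple of
  \<open>p\<close>, up to a small mass.\<close>

context
  fixes p :: "'a::euclidean_space \<Rightarrow> real"
  assumes p_int [measurable]: "integrable lborel p" and p_one: "integral\<^sup>L lborel p = 1"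
    and p_nonneg: "\<And>u. 0 \<le> p u" and p_pos: "AE u in lborel. 0 < p u"
begin

lemma density_borel: "p \<in> borel_measurable borel"
  by measurable

lemma density_shift: "integrable lborel (\<lambda>u. p (u - b))" "(LINT u|lborel. p (u - b)) = 1"
  using lborel_translation[OF density_borel, of "- b"] p_int p_one by simp_all

text \<open>The bound is only almost everywhere so that the lemma also covers essentially bounded
  functions.\<close>

lemma integrable_bounded_times_density:
  assumes [measurable]: "h \<in> borel_measurable borel" and "AE u in lborel. \<bar>h u\<bar> \<le> C"
  shows "integrable lborel (\<lambda>u. h u * p (u - b))"
proof (rule Bochner_Integration.integrable_bound)
  show "integrable lborel (\<lambda>u. C * p (u - b))" using density_shift by simp
  show "AE u in lborel. norm (h u * p (u - b)) \<le> norm (C * p (u - b))"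
    using assms(2) by eventually_elim (auto simp: abs_mult p_nonneg intro!: mult_right_mono)
qed simp

lemma excess_integrable:
  assumes "0 \<le> T"
  shows "integrable lborel (\<lambda>u. max 0 (p (u - b) - T * p u))"
proof (rule Bochner_Integration.integrable_bound[OF density_shift(1)[of b]])
  have "norm (max 0 (p (u - b) - T * p u)) \<le> norm (p (u - b))" for u
    using p_nonneg[of "u - b"] mult_nonneg_nonneg[OF assms p_nonneg[of u]] by (auto simp: max_def)
  then show "AE u in lborel. norm (max 0 (p (u - b) - T * p u)) \<le> norm (p (u - b))" by simp
qed simp

text \<open>Wherever \<open>p u > 0\<close> the integrand is eventually 0, and
  \<open>p (u - b)\<close> is an integrable majorant, so dominated convergence applies.\<close>

lemma excess_tendsto_0:
  "(\<lambda>k. LINT u|lborel. max 0 (p (u - b) - real k * p u)) \<longlonglongrightarrow> 0"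
proof -
  have "(\<lambda>k. LINT u|lborel. max 0 (p (u - b) - real k * p u))
      \<longlonglongrightarrow> (LINT u|(lborel :: 'a measure). (0::real))"
  proof (rule integral_dominated_convergence[where w = "\<lambda>u. p (u - b)"])
    show "AE u in lborel. (\<lambda>k. max 0 (p (u - b) - real k * p u)) \<longlonglongrightarrow> 0"
      using p_pos
    proof eventually_elim
      fix u assume "0 < p u"
      then have "eventually (\<lambda>k. p (u - b) / p u \<le> real k) sequentially"
        using filterlim_real_sequentially by (simp add: filterlim_at_top)
      then have "eventually (\<lambda>k. max 0 (p (u - b) - real k * p u) = 0) sequentially"
        by eventually_elim (use \<open>0 < p u\<close> in \<open>auto simp: divide_le_eq max_def\<close>)
      then show "(\<lambda>k. max 0 (p (u - b) - real k * p u)) \<longlonglongrightarrow> 0"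
        by (rule tendsto_eventually)
    qed
    show "AE u in lborel. norm (max 0 (p (u - b) - real k * p u)) \<le> p (u - b)" for k
    proof (intro AE_I2)
      fix u show "norm (max 0 (p (u - b) - real k * p u)) \<le> p (u - b)"
        using p_nonneg[of "u - b"] mult_nonneg_nonneg[OF of_nat_0_le_iff[of k] p_nonneg[of u]]
        by (auto simp: max_def)
    qed
  qed (use density_shift in simp_all)
  then show ?thesis by simp
qed

text \<open>Harnack-type estimate: splitting \<open>p (u - b)\<close> into its part below \<open>k * p u\<close> and the excess
  gives \<open>G (x + b) \<le> k * G x + K * \<delta> k\<close> with \<open>\<delta> k \<longlonglongrightarrow> 0\<close>, uniformly in \<open>x\<close>.\<close>

lemma average_near_zero:
  assumes [measurable]: "G \<in> borel_measurable borel"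
    and G: "\<And>x. 0 \<le> G x" "\<And>x. G x \<le> K" "\<And>x. G x = (LINT u|lborel. G (x + u) * p u)"
    and "0 < \<eta>"
  obtains \<epsilon> where "0 < \<epsilon>" "\<And>x. G x < \<epsilon> \<Longrightarrow> G (x + b) < \<eta>"
proof -
  define \<delta> where "\<delta> k = (LINT u|lborel. max 0 (p (u - b) - real k * p u))" for k
  have K: "0 \<le> K" using G(1,2)[of 0] by linarith
  have step: "G (x + b) \<le> real k * G x + K * \<delta> k" for x k
  proof -
    let ?e = "\<lambda>u. max 0 (p (u - b) - real k * p u)"
    have b: "AE u in lborel. \<bar>G (x + u)\<bar> \<le> K" using G(1,2) by simp
    have i: "integrable lborel (\<lambda>u. G (x + u) * p (u - c))" for c
      by (rule integrable_bounded_times_density[OF _ b]) simp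
    have i0: "integrable lborel (\<lambda>u. G (x + u) * p u)" using i[of 0] by simp
    have e: "integrable lborel ?e" by (rule excess_integrable) simp
    have "G (x + b) = (LINT u|lborel. G (x + b + u) * p u)" by (rule G(3))
    also have "\<dots> = (LINT u|lborel. G (x + u) * p (u - b))"
      using lborel_translation(2)[of "\<lambda>u. G (x + u) * p (u - b)" b] by (simp add: algebra_simps)
    also have "\<dots> \<le> (LINT u|lborel. real k * (G (x + u) * p u) + K * ?e u)"
    proof (rule integral_mono)
      fix u
      have "G (x + u) * p (u - b) \<le> G (x + u) * (real k * p u + ?e u)"
        using G(1) by (intro mult_left_mono) auto
      also have "\<dots> \<le> real k * (G (x + u) * p u) + K * ?e u"
        using mult_right_mono[OF G(2)[of "x + u"], of "?e u"] by (simp add: algebra_simps)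
      finally show "G (x + u) * p (u - b) \<le> real k * (G (x + u) * p u) + K * ?e u" .
    qed (use i i0 e in auto)
    also have "\<dots> = real k * G x + K * \<delta> k"
      using i0 e by (simp add: \<delta>_def G(3)[of x, symmetric])
    finally show ?thesis .
  qed
  have "(\<lambda>k. K * \<delta> k) \<longlonglongrightarrow> 0"
    using tendsto_mult_left[OF excess_tendsto_0[of b], of K] by (simp add: \<delta>_def)
  then have "eventually (\<lambda>k. K * \<delta> k < \<eta> / 2) sequentially"
    using \<open>0 < \<eta>\<close> by (intro order_tendstoD(2)) auto
  then obtain k where k: "K * \<delta> k < \<eta> / 2" by (auto simp: eventually_sequentially)
  show ?thesis
  proof
    \<comment> \<open>One half of \<open>\<eta>\<close> pays for the excess term, the other for
      \<open>k * G x\<close>; dividing by \<open>k + 1\<close> instead of \<open>k\<close> also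
      covers \<open>k = 0\<close>.\<close>
    show "0 < \<eta> / (2 * (real k + 1))" using \<open>0 < \<eta>\<close> by simp
    fix x assume "G x < \<eta> / (2 * (real k + 1))"
    then have "(real k + 1) * G x < \<eta> / 2" by (simp add: field_simps)
    then show "G (x + b) < \<eta>" using step[of x k] k G(1)[of x] by (simp add: algebra_simps)
  qed
qed

text \<open>If \<open>M = sup (F (x + a) - F x)\<close> were positive, then by the previous estimate the increment
  would stay above \<open>M / 2\<close> along an arbitrarily long progression \<open>x, x + a, \<dots>\<close>, and \<open>F\<close> would be
  unbounded.\<close>

lemma average_fixed_le:
  assumes [measurable]: "F \<in> borel_measurable borel"
    and bound: "\<And>x. \<bar>F x\<bar> \<le> C" and avg: "\<And>x. F x = (LINT u|lborel. F (x + u) * p u)"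
  shows "F (y + a) \<le> F y"
proof -
  define g where "g x = F (x + a) - F x" for x
  define M where "M = (SUP x. g x)"
  have [measurable]: "g \<in> borel_measurable borel" unfolding g_def by measurable
  have g2C: "\<bar>g x\<bar> \<le> 2 * C" for x
    using bound[of x] bound[of "x + a"] by (simp add: g_def)
  then have bdd: "bdd_above (range g)" by (intro bdd_aboveI[of _ "2 * C"]) (auto simp: abs_le_iff)
  have gM: "g x \<le> M" for x unfolding M_def using bdd by (intro cSUP_upper) auto
  have int: "integrable lborel (\<lambda>u. f (x + u) * p u)"
    if [measurable]: "f \<in> borel_measurable borel" and "\<And>x. \<bar>f x\<bar> \<le> D" for f x and D :: real
    using integrable_bounded_times_density[of "\<lambda>u. f (x + u)" D 0] that by simp
  have gavg: "g x = (LINT u|lborel. g (x + u) * p u)" for x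
  proof -
    have "g x = (LINT u|lborel. F (x + a + u) * p u) - (LINT u|lborel. F (x + u) * p u)"
      using avg[of "x + a"] avg[of x] by (simp add: g_def)
    also have "\<dots> = (LINT u|lborel. F (x + a + u) * p u - F (x + u) * p u)"
      by (rule Bochner_Integration.integral_diff[symmetric]) (auto intro!: int bound)
    finally show ?thesis by (simp add: g_def algebra_simps)
  qed
  have Gavg: "M - g x = (LINT u|lborel. (M - g (x + u)) * p u)" for x
  proof -
    have "(LINT u|lborel. (M - g (x + u)) * p u) = (LINT u|lborel. M * p u - g (x + u) * p u)"
      by (simp add: algebra_simps)
    also have "\<dots> = M - g x"
      by (subst Bochner_Integration.integral_diff) (auto simp: gavg[symmetric] p_int p_one intro!: int g2C)
    finally show ?thesis by simp
  qed
  have "M \<le> 0"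
  proof (rule ccontr)
    assume "\<not> M \<le> 0"
    then have M: "0 < M" by simp
    \<comment> \<open>With this many increments of size at least \<open>M / 2\<close>, the
      telescoped sum exceeds \<open>2 * C\<close>, the largest possible oscillation of
      \<open>F\<close>.\<close>
    obtain k :: nat where k: "2 * C < real k * (M / 2)"
      using reals_Archimedean3[of "M / 2"] M half_gt_zero by metis
    \<comment> \<open>The function \<open>M - g\<close> is nonnegative, bounded by
      \<open>M + 2 * C\<close> and again a fixed point, so smallness at \<open>x\<close> spreads to
      \<open>x + j a\<close>.\<close>
    have "\<exists>\<epsilon>>0. \<forall>x. M - g x < \<epsilon> \<longrightarrow> M - g (x + real j *\<^sub>R a) < M / 2" for j :: nat
    proof -
      have "M - g x \<le> M + 2 * C" for x using g2C[of x] by linarith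
      moreover have "0 \<le> M - g x" for x using gM[of x] by simp
      ultimately obtain \<epsilon> where "0 < \<epsilon>" "\<And>x. M - g x < \<epsilon> \<Longrightarrow> M - g (x + real j *\<^sub>R a) < M / 2"
        using average_near_zero[of "\<lambda>x. M - g x" "M + 2 * C" "M / 2" "real j *\<^sub>R a", OF _ _ _ Gavg] M
        by (auto simp del: diff_ge_0_iff_ge)
      then show ?thesis by blast
    qed
    then obtain e where e: "\<And>j::nat. e j > 0"
        "\<And>j x. M - g x < e j \<Longrightarrow> M - g (x + real j *\<^sub>R a) < M / 2"
      by metis
    \<comment> \<open>One tolerance serves all \<open>j < k\<close>; the inserted 1 keeps the set
      nonempty even for \<open>k = 0\<close>.\<close>
    define \<epsilon> where "\<epsilon> = Min (insert 1 (e ` {..<k}))"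
    have "\<epsilon> > 0" using e(1) by (auto simp: \<epsilon>_def)
    then have "M - \<epsilon> < M" by simp
    then obtain x where x: "M - \<epsilon> < g x"
      unfolding M_def using bdd by (subst (asm) less_cSUP_iff) auto
    have "M / 2 \<le> g (x + real j *\<^sub>R a)" if "j < k" for j
    proof -
      have "\<epsilon> \<le> e j" using that by (auto simp: \<epsilon>_def)
      then show ?thesis using e(2)[of x j] x by simp
    qed
    then have "(\<Sum>j<k. M / 2) \<le> (\<Sum>j<k. g (x + real j *\<^sub>R a))" by (intro sum_mono) auto
    also have "\<dots> = (\<Sum>j<k. F (x + real (Suc j) *\<^sub>R a) - F (x + real j *\<^sub>R a))"
      by (simp add: g_def algebra_simps)
    also have "\<dots> = F (x + real k *\<^sub>R a) - F x"
      by (subst sum_lessThan_telescope) simp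
    also have "\<dots> \<le> 2 * C" using bound[of "x + real k *\<^sub>R a"] bound[of x] by linarith
    finally show False using k by simp
  qed
  then show ?thesis using gM[of y] by (simp add: g_def)
qed

text \<open>The convolution \<open>F\<close> is a representative of \<open>f\<close> that is bounded
  and satisfies the averaging identity at every point, as the previous lemma requires.\<close>

theorem average_fixed_AE_constant:
  assumes [measurable]: "f \<in> borel_measurable borel" and bound: "AE x in lborel. \<bar>f x\<bar> \<le> C"
    and avg: "AE x in lborel. (LINT w|lborel. f w * p (w - x)) = f x"
  shows "\<exists>c. AE x in lborel. f x = c"
proof -
  define F where "F x = (LINT w|lborel. f w * p (w - x))" for x
  have [measurable]: "F \<in> borel_measurable borel"
    unfolding F_def by (intro lborel.borel_measurable_lebesgue_integral) measurable
  have eq: "AE x in lborel. F x = f x" using avg by (simp add: F_def)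
  have FC: "\<bar>F x\<bar> \<le> C" for x
  proof -
    have "\<bar>F x\<bar> \<le> (LINT w|lborel. norm (f w * p (w - x)))"
      unfolding F_def using integral_norm_bound by fastforce
    also have "\<dots> \<le> (LINT w|lborel. C * p (w - x))"
    proof (rule integral_mono_AE)
      show "AE w in lborel. norm (f w * p (w - x)) \<le> C * p (w - x)"
        using bound by eventually_elim (auto simp: abs_mult p_nonneg intro!: mult_right_mono)
    qed (use density_shift in \<open>auto intro!: integrable_norm integrable_bounded_times_density[OF _ bound]\<close>)
    also have "\<dots> = C" by (simp add: density_shift)
    finally show ?thesis .
  qed
  have Favg: "F x = (LINT u|lborel. F (x + u) * p u)" for x
  proof -
    have "(LINT u|lborel. F (x + u) * p u) = (LINT w|lborel. F w * p (w - x))"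
      using lborel_translation(2)[of "\<lambda>w. F w * p (w - x)" x] by (simp add: algebra_simps)
    also have "\<dots> = F x"
      unfolding F_def[of x] by (rule integral_cong_AE) (use eq in \<open>auto\<close>)
    finally show ?thesis by simp
  qed
  \<comment> \<open>Translating from 0 by \<open>x\<close> and from \<open>x\<close> by
    \<open>- x\<close> gives both inequalities.\<close>
  have const: "F x = F 0" for x
    using average_fixed_le[OF _ FC Favg, of 0 x] average_fixed_le[OF _ FC Favg, of x "- x"] by simp
  have "AE x in lborel. f x = F 0"
    using eq by eventually_elim (metis const)
  then show ?thesis ..
qed

end

section \<open>The squared kernel as a probability density\<close>

text \<open>The disc where \<open>(cmod z)\<^sup>2 \<le> a\<close> has area \<open>pi * a\<close>,
  linear in \<open>a\<close>, so the squared modulus pushes area forward to \<open>pi\<close> times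
  Lebesgue measure on the half-line. This replaces polar coordinates.\<close>

lemma nn_integral_complex_radial:
  assumes [measurable]: "h \<in> borel_measurable borel"
  shows "(\<integral>\<^sup>+z. h ((cmod z)\<^sup>2) \<partial>lborel) = (\<integral>\<^sup>+x. ennreal (pi * indicator {0..} x) * h x \<partial>lborel)"
proof -
  have "distributed lborel lborel (\<lambda>z::complex. (cmod z)\<^sup>2) (\<lambda>x. pi * indicator {0..} x :: real)"
  proof (rule distributedI_borel_atMost[where g = "\<lambda>a. pi * max 0 a"])
    fix a :: real
    have "(\<integral>\<^sup>+x. ennreal (pi * indicator {0..} x * indicator {..a} x) \<partial>lborel)
        = (\<integral>\<^sup>+x. ennreal pi * indicator {0..a} x \<partial>lborel)"
      by (intro nn_integral_cong) (auto simp: indicator_def)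
    also have "\<dots> = ennreal (pi * max 0 a)"
      by (subst nn_integral_cmult_indicator) (auto simp: ennreal_mult max_def not_le)
    finally show "(\<integral>\<^sup>+x. ennreal (pi * indicator {0..} x * indicator {..a} x) \<partial>lborel)
        = ennreal (pi * max 0 a)" .
    show "emeasure lborel {z \<in> space lborel. (cmod z)\<^sup>2 \<le> a} = ennreal (pi * max 0 a)"
    proof (cases "0 \<le> a")
      case True
      then have "{z \<in> space lborel. (cmod z)\<^sup>2 \<le> a} = cball 0 (sqrt a)"
        by (auto simp: real_le_rsqrt intro: sqrt_ge_absD)
      then show ?thesis
        using True emeasure_cball[of "sqrt a" "0::complex"] by (simp add: unit_ball_vol_2)
    next
      case False
      then have "{z \<in> space lborel. (cmod z)\<^sup>2 \<le> a} = {}"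
        by (auto simp: not_le intro: less_le_trans)
      then show ?thesis using False by simp
    qed
  qed simp_all
  from distributed_nn_integral[OF this, of h] show ?thesis by simp
qed

text \<open>In the variable \<open>x = (cmod z)\<^sup>2\<close> this is \<open>pi\<close> times the
  Gamma integral of \<open>x ^ k * exp (- x)\<close>.\<close>

lemma complex_gaussian_moment:
  "has_bochner_integral lborel (\<lambda>z::complex. (cmod z) ^ (2 * k) * exp (- (cmod z)\<^sup>2)) (pi * fact k)"
proof (rule has_bochner_integral_nn_integral)
  have "(\<integral>\<^sup>+z. ennreal ((cmod z) ^ (2 * k) * exp (- (cmod z)\<^sup>2)) \<partial>lborel)
      = (\<integral>\<^sup>+x. ennreal (pi * indicator {0..} x) * ennreal (x ^ k * exp (- x)) \<partial>lborel)"
    using nn_integral_complex_radial[of "\<lambda>x. ennreal (x ^ k * exp (- x))"] by (simp add: power_mult)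
  also have "\<dots> = (\<integral>\<^sup>+x. ennreal pi * (ennreal (x ^ k * exp (- x)) * indicator {0..} x) \<partial>lborel)"
    by (intro nn_integral_cong) (auto simp: indicator_def)
  also have "\<dots> = ennreal (pi * fact k)"
    by (simp add: nn_integral_cmult nn_intergal_power_times_exp_Ici ennreal_mult)
  finally show "(\<integral>\<^sup>+z. ennreal ((cmod z) ^ (2 * k) * exp (- (cmod z)\<^sup>2)) \<partial>lborel)
      = ennreal (pi * fact k)" .
qed simp_all

section \<open>Normalization of the squared Laguerre polynomial\<close>

text \<open>Up to sign this is the \<open>m\<close>-th finite difference of a polynomial of degree
  \<open>i < m\<close>. Pascal's rule in \<open>m\<close> produces a first difference, which lowers
  \<open>i\<close> by one, and induction applies.\<close>

lemma alternating_sum_gbinomial_eq_0: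
  fixes a :: "'a::field_char_0"
  assumes "i < m"
  shows "(\<Sum>k\<le>m. (-1) ^ k * of_nat (m choose k) * ((a + of_nat k) gchoose i)) = 0"
  using assms
proof (induction m arbitrary: i)
  case (Suc m)
  let ?g = "\<lambda>k. (a + of_nat k) gchoose i :: 'a"
  let ?t = "\<lambda>k. (-1) ^ k * of_nat (m choose k) :: 'a"
  have "(\<Sum>k\<le>Suc m. (-1) ^ k * of_nat (Suc m choose k) * ?g k)
      = ?g 0 + (\<Sum>k\<le>m. (-1) ^ Suc k * of_nat (Suc m choose Suc k) * ?g (Suc k))"
    by (subst sum.atMost_Suc_shift) simp
  also have "\<dots> = ?g 0 + (\<Sum>k\<le>m. (-1) ^ Suc k * of_nat (m choose Suc k) * ?g (Suc k))
      - (\<Sum>k\<le>m. ?t k * ?g (Suc k))"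
    by (simp add: sum_subtractf sum_negf sum.distrib algebra_simps)
  also have "?g 0 + (\<Sum>k\<le>m. (-1) ^ Suc k * of_nat (m choose Suc k) * ?g (Suc k)) = (\<Sum>k\<le>Suc m. ?t k * ?g k)"
    by (subst sum.atMost_Suc_shift) simp
  also have "\<dots> = (\<Sum>k\<le>m. ?t k * ?g k)" by simp
  also have "(\<Sum>k\<le>m. ?t k * ?g k) - (\<Sum>k\<le>m. ?t k * ?g (Suc k)) = - (\<Sum>k\<le>m. ?t k * (?g (Suc k) - ?g k))"
    by (simp add: sum_subtractf[symmetric] sum_negf[symmetric] algebra_simps)
  also have "\<dots> = 0"
  proof (cases i)
    case (Suc j)
    have "?g (Suc k) - ?g k = (a + of_nat k) gchoose j" for k
      using gbinomial_Suc_Suc[of "a + of_nat k" j] by (simp add: Suc add_ac)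
    then show ?thesis using Suc.IH[of j] Suc.prems Suc by simp
  qed simp
  finally show ?case .
qed simp

text \<open>The binomial coefficient is a polynomial of degree \<open>i\<close> in \<open>j\<close>, and the sum lacks only the
  term \<open>j = -1\<close> of a vanishing alternating sum.\<close>

lemma laguerre_gram_row:
  assumes "i \<le> N"
  shows "(\<Sum>j\<le>N. (-1) ^ j * real (Suc N choose Suc j) * real ((i + j) choose i)) = (if i = 0 then 1 else 0)"
proof -
  let ?g = "\<lambda>k. (real i - 1 + real k) gchoose i"
  have "0 = (\<Sum>k\<le>Suc N. (-1) ^ k * real (Suc N choose k) * ?g k)"
    using alternating_sum_gbinomial_eq_0[of i "Suc N" "real i - 1"] assms by simp
  also have "\<dots> = ?g 0 - (\<Sum>j\<le>N. (-1) ^ j * real (Suc N choose Suc j) * ?g (Suc j))"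
    by (subst sum.atMost_Suc_shift) (simp add: sum_negf[symmetric])
  also have "(\<Sum>j\<le>N. (-1) ^ j * real (Suc N choose Suc j) * ?g (Suc j))
     = (\<Sum>j\<le>N. (-1) ^ j * real (Suc N choose Suc j) * real ((i + j) choose i))"
    by (intro sum.cong) (auto simp: binomial_gbinomial algebra_simps)
  \<comment> \<open>The split-off term is \<open>i - 1\<close> choose \<open>i\<close>: the empty
    product 1 for \<open>i = 0\<close>, and zero otherwise.\<close>
  also have "?g 0 = (if i = 0 then 1 else 0)"
  proof (cases i)
    case (Suc m)
    then have "?g 0 = real (m choose i)" by (simp add: binomial_gbinomial)
    then show ?thesis by (simp add: Suc)
  qed simp
  finally show ?thesis by simp
qed

lemma laguerre_one_coeffs:
  "laguerre 1 N x = (\<Sum>j\<le>N. real (Suc N choose Suc j) * (- x) ^ j / fact j)"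
  unfolding laguerre_def
proof (intro sum.cong refl)
  fix j assume "j \<in> {..N}"
  then have "Suc N choose (N - j) = Suc N choose Suc j"
    using binomial_symmetric[of "N - j" "Suc N"] by (simp add: Suc_diff_le del: binomial_Suc_Suc)
  then have "(real N + 1) gchoose (N - j) = real (Suc N choose Suc j)"
    using binomial_gbinomial[of "Suc N" "N - j", where 'a = real] by (simp add: add.commute del: binomial_Suc_Suc)
  then show "((real N + 1) gchoose (N - j)) * (- x) ^ j / fact j = real (Suc N choose Suc j) * (- x) ^ j / fact j"
    by simp
qed

definition berezin_density :: "nat \<Rightarrow> complex \<Rightarrow> real" where
  "berezin_density n u = (laguerre 1 (n - 1) ((cmod u)\<^sup>2))\<^sup>2 * exp (- (cmod u)\<^sup>2) / (real n * pi)"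

text \<open>The weight is \<open>exp (- x)\<close>, not the orthogonality weight
  \<open>x * exp (- x)\<close> of these polynomials, so the square is expanded. The moments turn the
  factorials into \<open>(i + j) choose i\<close>, and every row sum but that of
  \<open>i = 0\<close> vanishes.\<close>

lemma berezin_density_integral:
  assumes "n \<ge> 1"
  shows "has_bochner_integral lborel (berezin_density n) 1"
proof -
  obtain N where n: "n = Suc N" using assms by (cases n) auto
  define c where "c j = (-1) ^ j * real (Suc N choose Suc j) / fact j" for j
  have L: "laguerre 1 N x = (\<Sum>j\<le>N. c j * x ^ j)" for x
    unfolding laguerre_one_coeffs c_def by (intro sum.cong) (auto simp: power_minus[of x])
  have eq: "berezin_density n u = (\<Sum>i\<le>N. \<Sum>j\<le>N. c i * c j / (real n * pi) *
      ((cmod u) ^ (2 * (i + j)) * exp (- (cmod u)\<^sup>2)))" for u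
  proof -
    have "(cmod u) ^ (2 * (i + j)) = ((cmod u)\<^sup>2) ^ i * ((cmod u)\<^sup>2) ^ j" for i j
      by (simp only: power_mult power_add)
    then have "(\<Sum>j\<le>N. c j * ((cmod u)\<^sup>2) ^ j)\<^sup>2 = (\<Sum>i\<le>N. \<Sum>j\<le>N. c i * c j * (cmod u) ^ (2 * (i + j)))"
      unfolding power2_eq_square[of "sum _ _"] sum_product
      by (intro sum.cong refl) (simp only: mult_ac)
    then show ?thesis
      by (simp add: berezin_density_def n L sum_distrib_left sum_divide_distrib mult_ac del: of_nat_Suc)
  qed
  have "has_bochner_integral lborel (berezin_density n)
      (\<Sum>i\<le>N. \<Sum>j\<le>N. c i * c j / (real n * pi) * (pi * fact (i + j)))"
    unfolding eq[abs_def] fun_eq_iff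
    by (intro has_bochner_integral_sum has_bochner_integral_mult_right complex_gaussian_moment)
  also have "(\<Sum>i\<le>N. \<Sum>j\<le>N. c i * c j / (real n * pi) * (pi * fact (i + j)))
     = (\<Sum>i\<le>N. (-1) ^ i * real (Suc N choose Suc i) / real n *
         (\<Sum>j\<le>N. (-1) ^ j * real (Suc N choose Suc j) * real ((i + j) choose i)))"
    by (simp add: c_def sum_distrib_left binomial_fact mult_ac del: binomial_Suc_Suc)
  also have "\<dots> = (\<Sum>i\<le>N. if i = 0 then 1 else 0)"
    by (intro sum.cong) (auto simp: laguerre_gram_row n simp del: binomial_Suc_Suc)
  finally show ?thesis by simp
qed

lemma berezin_density_nonneg: "0 \<le> berezin_density n u"
  by (simp add: berezin_density_def)

text \<open>The Laguerre polynomial has constant term \<open>n\<close>, hence is nonzero with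
  finitely many roots, and the density vanishes only on the corresponding circles.\<close>

lemma berezin_density_pos_AE:
  assumes "n \<ge> 1"
  shows "AE u in lborel. 0 < berezin_density n u"
proof -
  obtain N where n: "n = Suc N" using assms by (cases n) auto
  define q where "q = (\<Sum>j\<le>N. monom (real (Suc N choose Suc j) * (-1) ^ j / fact j) j)"
  have q: "poly q x = laguerre 1 N x" for x
    by (simp add: q_def laguerre_one_coeffs poly_sum poly_monom power_minus[of x] mult.assoc del: binomial_Suc_Suc)
  have "poly q 0 = real (Suc N)"
    unfolding q laguerre_one_coeffs by (subst sum.remove[of _ 0]) auto
  then have "q \<noteq> 0" by auto
  then have "finite {x. poly q x = 0}" by (rule poly_roots_finite)
  \<comment> \<open>A negative root \<open>r\<close> gives a negative radius and thus an empty
    sphere.\<close>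
  then have "negligible (\<Union>r \<in> {x. poly q x = 0}. sphere (0::complex) (sqrt r))"
    by (intro negligible_Union) (auto simp: negligible_sphere)
  moreover have "{u. \<not> 0 < berezin_density n u} \<subseteq> (\<Union>r \<in> {x. poly q x = 0}. sphere (0::complex) (sqrt r))"
    by (auto simp: berezin_density_def n q zero_less_divide_iff zero_less_mult_iff not_less
        intro!: exI[of _ "(cmod _)\<^sup>2"])
  ultimately have "{u. \<not> 0 < berezin_density n u} \<in> null_sets lebesgue"
    using negligible_subset negligible_iff_null_sets by blast
  then have "AE u in lebesgue. 0 < berezin_density n u" by (auto simp: AE_iff_null_sets[symmetric] eventually_ae_filter)
  then show ?thesis by (simp add: AE_completion_iff)
qed

section \<open>Bounded harmonic functions\<close>

text \<open>The mean value theorem is applied twice: in direction \<open>a\<close> to the increment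
  of \<open>u\<close> by \<open>t *\<^sub>R b\<close>, then in direction \<open>b\<close> to
  \<open>ua\<close>.\<close>

lemma second_difference_mvt:
  fixes u :: "'a::real_normed_vector \<Rightarrow> real"
  assumes ua: "\<And>z. ((\<lambda>s. u (z + s *\<^sub>R a)) has_real_derivative ua z) (at 0)"
    and uab: "\<And>z. ((\<lambda>s. ua (z + s *\<^sub>R b)) has_real_derivative uab z) (at 0)"
    and "0 < t"
  obtains s r where "0 < s" "s < t" "0 < r" "r < t"
    "u (z + t *\<^sub>R a + t *\<^sub>R b) - u (z + t *\<^sub>R a) - u (z + t *\<^sub>R b) + u z = t\<^sup>2 * uab (z + s *\<^sub>R a + r *\<^sub>R b)"
proof -
  \<comment> \<open>Differentiability at parameter 0 for every base point gives it at every
    parameter of the line.\<close>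
  have shift: "((\<lambda>s. f (z + s *\<^sub>R c)) has_real_derivative f' (z + s\<^sub>0 *\<^sub>R c)) (at s\<^sub>0)"
    if "\<And>z. ((\<lambda>s. f (z + s *\<^sub>R c)) has_real_derivative f' z) (at 0)"
    for f f' :: "'a \<Rightarrow> real" and z c s\<^sub>0
  proof -
    have "z + s\<^sub>0 *\<^sub>R c + s *\<^sub>R c = z + (s + s\<^sub>0) *\<^sub>R c" for s
      by (simp only: scaleR_add_left add_ac)
    with that[of "z + s\<^sub>0 *\<^sub>R c"]
    have "((\<lambda>s. f (z + (s + s\<^sub>0) *\<^sub>R c)) has_real_derivative f' (z + s\<^sub>0 *\<^sub>R c)) (at 0)"
      by (simp only:)
    then show ?thesis
      using DERIV_shift[of "\<lambda>s. f (z + s *\<^sub>R c)" _ 0 s\<^sub>0] by simp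
  qed
  have "((\<lambda>s. u (z + t *\<^sub>R b + s *\<^sub>R a) - u (z + s *\<^sub>R a)) has_real_derivative
      ua (z + t *\<^sub>R b + s *\<^sub>R a) - ua (z + s *\<^sub>R a)) (at s)" for s
    by (rule DERIV_diff[OF shift[OF ua, of "z + t *\<^sub>R b"] shift[OF ua, of z]])
  from MVT2[OF \<open>0 < t\<close> this] obtain s where s: "0 < s" "s < t"
    "u (z + t *\<^sub>R b + t *\<^sub>R a) - u (z + t *\<^sub>R a) - (u (z + t *\<^sub>R b) - u z)
      = t * (ua (z + t *\<^sub>R b + s *\<^sub>R a) - ua (z + s *\<^sub>R a))" by auto
  from MVT2[OF \<open>0 < t\<close> shift[OF uab, of "z + s *\<^sub>R a"]] obtain r where r: "0 < r" "r < t"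
    "ua (z + s *\<^sub>R a + t *\<^sub>R b) - ua (z + s *\<^sub>R a) = t * uab (z + s *\<^sub>R a + r *\<^sub>R b)" by auto
  show ?thesis
    by (rule that[OF s(1,2) r(1,2)]) (use s(3) r(3) in \<open>simp add: power2_eq_square algebra_simps\<close>)
qed

text \<open>The second difference is symmetric in \<open>a\<close> and \<open>b\<close>, so both
  mixed derivatives take a common value at points arbitrarily close to \<open>z\<close>; continuity
  concludes.\<close>

lemma mixed_derivatives_eq:
  fixes u :: "'a::real_normed_vector \<Rightarrow> real"
  assumes ua: "\<And>z. ((\<lambda>s. u (z + s *\<^sub>R a)) has_real_derivative ua z) (at 0)"
    and uab: "\<And>z. ((\<lambda>s. ua (z + s *\<^sub>R b)) has_real_derivative uab z) (at 0)"
    and ub: "\<And>z. ((\<lambda>s. u (z + s *\<^sub>R b)) has_real_derivative ub z) (at 0)"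
    and uba: "\<And>z. ((\<lambda>s. ub (z + s *\<^sub>R a)) has_real_derivative uba z) (at 0)"
    and cont: "isCont uab z" "isCont uba z"
  shows "uab z = uba z"
proof (rule ccontr)
  assume ne: "uab z \<noteq> uba z"
  define e where "e = \<bar>uab z - uba z\<bar> / 2"
  have "e > 0" using ne by (simp add: e_def)
  then obtain d1 d2 where d: "0 < d1" "0 < d2"
      "\<And>w. dist w z < d1 \<Longrightarrow> dist (uab w) (uab z) < e" "\<And>w. dist w z < d2 \<Longrightarrow> dist (uba w) (uba z) < e"
    using cont unfolding continuous_at_eps_delta by metis
  \<comment> \<open>This size keeps all intermediate points of the parallelogram within
    \<open>min d1 d2\<close> of \<open>z\<close>.\<close>
  define t where "t = min d1 d2 / (norm a + norm b + 1)"
  have t: "0 < t" using d(1,2) by (auto simp: t_def intro!: divide_pos_pos add_nonneg_pos)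
  have near: "dist (z + s *\<^sub>R x + r *\<^sub>R y) z < min d1 d2"
    if "0 < s" "s < t" "0 < r" "r < t" "{x, y} = {a, b}" for s r x y
  proof -
    have "dist (z + s *\<^sub>R x + r *\<^sub>R y) z \<le> norm (s *\<^sub>R x) + norm (r *\<^sub>R y)"
      using norm_triangle_ineq[of "s *\<^sub>R x" "r *\<^sub>R y"] by (simp add: dist_norm add.assoc)
    also have "\<dots> \<le> t * norm x + t * norm y" using that by (auto intro!: add_mono mult_right_mono)
    also have "\<dots> = t * (norm a + norm b)" using that(5) by (auto simp: doubleton_eq_iff algebra_simps)
    also have "\<dots> < t * (norm a + norm b + 1)" using t by simp
    also have "\<dots> = min d1 d2"
      using add_nonneg_pos[of "norm a + norm b" 1] by (simp add: t_def)
    finally show ?thesis .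
  qed
  obtain s r where 1: "0 < s" "s < t" "0 < r" "r < t"
    "u (z + t *\<^sub>R a + t *\<^sub>R b) - u (z + t *\<^sub>R a) - u (z + t *\<^sub>R b) + u z = t\<^sup>2 * uab (z + s *\<^sub>R a + r *\<^sub>R b)"
    using second_difference_mvt[OF ua uab t] by metis
  obtain s' r' where 2: "0 < s'" "s' < t" "0 < r'" "r' < t"
    "u (z + t *\<^sub>R b + t *\<^sub>R a) - u (z + t *\<^sub>R b) - u (z + t *\<^sub>R a) + u z = t\<^sup>2 * uba (z + s' *\<^sub>R b + r' *\<^sub>R a)"
    using second_difference_mvt[OF ub uba t] by metis
  have "t\<^sup>2 * uab (z + s *\<^sub>R a + r *\<^sub>R b) = t\<^sup>2 * uba (z + s' *\<^sub>R b + r' *\<^sub>R a)"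
    unfolding 1(5)[symmetric] 2(5)[symmetric] by (simp add: algebra_simps)
  then have "uab (z + s *\<^sub>R a + r *\<^sub>R b) = uba (z + s' *\<^sub>R b + r' *\<^sub>R a)" using t by simp
  moreover have "dist (uab (z + s *\<^sub>R a + r *\<^sub>R b)) (uab z) < e"
    using near[OF 1(1-4), of a b] by (intro d(3)) simp
  moreover have "dist (uba (z + s' *\<^sub>R b + r' *\<^sub>R a)) (uba z) < e"
    using near[OF 2(1-4), of b a] by (intro d(4)) (simp add: insert_commute)
  ultimately show False unfolding e_def dist_real_def by argo
qed

lemma has_derivative_directional:
  assumes "(f has_derivative D) (at z)"
  shows "((\<lambda>s. f (z + s *\<^sub>R a)) has_real_derivative D a) (at 0)"
proof -
  interpret D: bounded_linear D using assms by (rule has_derivative_bounded_linear)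
  have "((\<lambda>s. z + s *\<^sub>R a) has_derivative (\<lambda>s. s *\<^sub>R a)) (at 0)"
    by (auto intro!: derivative_eq_intros)
  from diff_chain_at[OF this, of f D] assms
  have "((\<lambda>s. f (z + s *\<^sub>R a)) has_derivative (\<lambda>s. D (s *\<^sub>R a))) (at 0)"
    by (simp add: o_def)
  then show ?thesis
    unfolding has_field_derivative_def
    by (elim has_derivative_eq_rhs) (simp add: D.scaleR fun_eq_iff)
qed

section \<open>Liouville property of harmonic functions\<close>

lemma bounded_harmonic_real_constant:
  fixes u :: "complex \<Rightarrow> real"
  assumes u: "\<And>z. (u has_derivative (\<lambda>v. Re v * u1 z + Im v * u2 z)) (at z)"
    and u1: "\<And>z. (u1 has_derivative (\<lambda>v. Re v * u11 z + Im v * u12 z)) (at z)"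
    and u2: "\<And>z. (u2 has_derivative (\<lambda>v. Re v * u21 z + Im v * u22 z)) (at z)"
    and cont: "\<And>z. isCont u12 z" "\<And>z. isCont u21 z"
    and laplace: "\<And>z. u11 z + u22 z = 0"
    and bound: "\<And>z. u z \<le> C"
  shows "u z = u w"
proof -
  have mixed: "u12 z = u21 z" for z
    using has_derivative_directional[OF u, of _ 1] has_derivative_directional[OF u, of _ \<i>]
      has_derivative_directional[OF u1, of _ \<i>] has_derivative_directional[OF u2, of _ 1]
    by (intro mixed_derivatives_eq[of u 1 u1 \<i> u12 u2 u21] cont) simp_all
  \<comment> \<open>Of the Cauchy-Riemann equations for \<open>g\<close>, one is the Laplace
    equation and the other is \<open>mixed\<close>.\<close>
  define g where "g z = Complex (u1 z) (- u2 z)" for z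
  have "(g has_field_derivative Complex (u11 z) (- u12 z)) (at z)" for z
  proof -
    have "(g has_derivative (\<lambda>v. of_real (Re v * u11 z + Im v * u12 z) - \<i> * of_real (Re v * u21 z + Im v * u22 z))) (at z)"
      unfolding g_def Complex_eq
      by (auto intro!: derivative_eq_intros u1 u2)
    moreover have "u22 z = - u11 z" using laplace[of z] by simp
    ultimately show ?thesis
      unfolding has_field_derivative_def
      by (elim has_derivative_eq_rhs) (auto simp: fun_eq_iff complex_eq_iff mixed algebra_simps)
  qed
  then have "g holomorphic_on UNIV" by (meson holomorphic_on_open open_UNIV)
  then obtain G where G: "\<And>z. (G has_field_derivative g z) (at z)"
    using holomorphic_convex_primitive'[of UNIV g] by auto
  have "((\<lambda>z. Re (G z) - u z) has_derivative (\<lambda>v. 0)) (at z)" for z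
  proof -
    have "((\<lambda>z. Re (G z)) has_derivative (\<lambda>v. Re (g z * v))) (at z)"
      using G[of z] unfolding has_field_derivative_def by (rule bounded_linear.has_derivative[OF bounded_linear_Re])
    from has_derivative_diff[OF this u[of z]] show ?thesis
      by (simp add: g_def algebra_simps)
  qed
  then obtain c where c: "\<And>z. Re (G z) - u z = c"
    using has_derivative_zero_constant[of UNIV "\<lambda>z. Re (G z) - u z"] by auto
  have "(\<lambda>z. exp (G z)) holomorphic_on UNIV"
    unfolding holomorphic_on_open[OF open_UNIV] using DERIV_chain2[OF DERIV_exp G] by blast
  moreover have "bounded (range (\<lambda>z. exp (G z)))"
    unfolding bounded_iff
  proof (intro exI[of _ "exp (C + c)"] ballI)
    fix y assume "y \<in> range (\<lambda>z. exp (G z))"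
    then obtain z where y: "y = exp (G z)" by auto
    \<comment> \<open>The upper bound on \<open>u\<close> enters through
      \<open>norm (exp (G z)) = exp (Re (G z))\<close>.\<close>
    show "norm y \<le> exp (C + c)" using c[of z] bound[of z] by (simp add: y norm_exp_eq_Re)
  qed
  ultimately have "(\<lambda>z. exp (G z)) constant_on UNIV" by (rule Liouville_theorem)
  then have "exp (G z) = exp (G w)" by (auto simp: constant_on_def)
  then have "Re (G z) = Re (G w)" by (metis exp_inj_iff norm_exp_eq_Re)
  then show ?thesis using c[of z] c[of w] by simp
qed

lemma C1_on_UNIV_complex:
  fixes f :: "complex \<Rightarrow> 'b::real_normed_vector"
  assumes "C1_on UNIV f"
  shows "(f has_derivative (\<lambda>v. Re v *\<^sub>R partial_deriv 1 f z + Im v *\<^sub>R partial_deriv \<i> f z)) (at z)"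
    and "isCont (partial_deriv 1 f) z" "isCont (partial_deriv \<i> f) z"
proof -
  have "f differentiable (at z)" using assms by (simp add: C1_on_def differentiable_on_def)
  then have D: "(f has_derivative frechet_derivative f (at z)) (at z)" by (simp add: frechet_derivative_works)
  interpret bounded_linear "frechet_derivative f (at z)" using D by (rule has_derivative_bounded_linear)
  have "frechet_derivative f (at z) v = Re v *\<^sub>R partial_deriv 1 f z + Im v *\<^sub>R partial_deriv \<i> f z" for v
  proof -
    have "v = Re v *\<^sub>R 1 + Im v *\<^sub>R \<i>" by (simp add: complex_eq_iff)
    then have "frechet_derivative f (at z) v = frechet_derivative f (at z) (Re v *\<^sub>R 1 + Im v *\<^sub>R \<i>)" by simp
    then show ?thesis by (simp only: add scaleR partial_deriv_def)
  qed
  then have "frechet_derivative f (at z) = (\<lambda>v. Re v *\<^sub>R partial_deriv 1 f z + Im v *\<^sub>R partial_deriv \<i> f z)" ..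
  with D show "(f has_derivative (\<lambda>v. Re v *\<^sub>R partial_deriv 1 f z + Im v *\<^sub>R partial_deriv \<i> f z)) (at z)" by simp
  show "isCont (partial_deriv 1 f) z" "isCont (partial_deriv \<i> f) z"
    using assms by (auto simp: C1_on_def Basis_complex_def continuous_on_eq_continuous_at)
qed

lemma bounded_harmonic_constant:
  fixes h :: "complex \<Rightarrow> complex"
  assumes "h harmonic_on UNIV" and bound: "\<And>z. cmod (h z) \<le> C"
  shows "h z = h w"
proof -
  let ?d = "\<lambda>b. partial_deriv b h"
  have C1: "C1_on UNIV h" "C1_on UNIV (?d 1)" "C1_on UNIV (?d \<i>)"
    and lap: "\<And>z. partial_deriv 1 (?d 1) z + partial_deriv \<i> (?d \<i>) z = 0"
    using assms(1) by (auto simp: harmonic_on_def C2_on_def laplacian_def Basis_complex_def)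
  \<comment> \<open>Taking \<open>T\<close> to be \<open>Re\<close> and \<open>Im\<close> reduces to
    real functions; \<open>T\<close> commutes with the derivatives and keeps the upper
    bound.\<close>
  have "T (h z) = T (h w)" if T: "bounded_linear T" "\<And>z. T z \<le> cmod z" for T :: "complex \<Rightarrow> real"
  proof -
    interpret T: bounded_linear T by fact
    have D: "((\<lambda>z. T (f z)) has_derivative (\<lambda>v. Re v * T (partial_deriv 1 f z) + Im v * T (partial_deriv \<i> f z))) (at z)"
      if "C1_on UNIV f" for f z
      using bounded_linear.has_derivative[OF T(1) C1_on_UNIV_complex(1)[OF that, of z]]
      by (simp add: T.add T.scaleR)
    show ?thesis
    proof (rule bounded_harmonic_real_constant[OF D[OF C1(1)] D[OF C1(2)] D[OF C1(3)]])
      show "isCont (\<lambda>z. T (partial_deriv \<i> (?d 1) z)) z" "isCont (\<lambda>z. T (partial_deriv 1 (?d \<i>) z)) z" for z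
        by (intro T.isCont C1_on_UNIV_complex C1)+
      show "T (partial_deriv 1 (?d 1) z) + T (partial_deriv \<i> (?d \<i>) z) = 0" for z
        using lap[of z] by (simp add: T.add[symmetric] T.zero)
      show "T (h z) \<le> C" for z using T(2)[of "h z"] bound[of z] by simp
    qed
  qed
  from this[OF bounded_linear_Re] this[OF bounded_linear_Im] show ?thesis
    by (simp add: complex_eq_iff complex_Re_le_cmod abs_Im_le_cmod abs_le_D1)
qed

text \<open>The set where the bound fails is open and negligible, hence empty.\<close>

lemma AE_bounded_continuous:
  fixes h :: "'a::euclidean_space \<Rightarrow> 'b::real_normed_vector"
  assumes "continuous_on UNIV h" and AE: "AE z in lebesgue. norm (h z) \<le> C"
  shows "norm (h z) \<le> C"
proof (rule ccontr)
  assume "\<not> norm (h z) \<le> C"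
  moreover have "open {z. C < norm (h z)}"
    using assms(1) by (intro open_Collect_less continuous_intros) auto
  moreover have "negligible {z. C < norm (h z)}"
    using AE unfolding eventually_ae_filter_negligible not_le by (blast intro: negligible_subset)
  ultimately show False by (metis open_not_negligible empty_iff mem_Collect_eq not_le)
qed

lemma constant_harmonic: "(\<lambda>_. c) harmonic_on UNIV"
proof -
  have "partial_deriv b (\<lambda>_::'a. c::'b) = (\<lambda>_. 0)" for b c
    by (simp add: partial_deriv_def fun_eq_iff frechet_derivative_const)
  then show ?thesis
    by (simp add: harmonic_on_def C2_on_def C1_on_def laplacian_def)
qed

section \<open>The Berezin transform\<close>

lemma fock_kernel_diagonal:
  assumes "n \<ge> 1"
  shows "csqrt (fock_kernel n z z) * cnj (csqrt (fock_kernel n z z)) = of_real (real n * exp ((cmod z)\<^sup>2))"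
proof -
  obtain N where n: "n = Suc N" using assms by (cases n) auto
  have "laguerre 1 N 0 = real n"
    unfolding laguerre_one_coeffs n by (subst sum.remove[of _ 0]) auto
  then have "fock_kernel n z z = of_real (real n * exp ((cmod z)\<^sup>2))"
    by (simp add: fock_kernel_def n complex_norm_square[symmetric] exp_of_real[symmetric])
  \<comment> \<open>The principal root of a nonnegative real is real, so conjugation fixes
    it.\<close>
  moreover have "csqrt (of_real x) * cnj (csqrt (of_real x)) = of_real x" if "0 \<le> x" for x
    using that by (simp flip: of_real_mult)
  ultimately show ?thesis by simp
qed

text \<open>Expanding \<open>(cmod (w - z))\<^sup>2\<close> shows that the Gaussian weight, the
  exponential factor of the kernel and its normalization combine into one Gaussian centred at
  \<open>z\<close>. This makes the transform a convolution.\<close>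

lemma normalized_kernel_density:
  assumes "n \<ge> 1"
  shows "exp (- (cmod w)\<^sup>2) / pi * (cmod (normalized_kernel n z w))\<^sup>2 = berezin_density n (w - z)"
proof -
  let ?s = "csqrt (fock_kernel n z z)"
  have "complex_of_real ((cmod ?s)\<^sup>2) = of_real (real n * exp ((cmod z)\<^sup>2))"
    using fock_kernel_diagonal[OF assms, of z] by (simp only: complex_norm_square)
  then have s: "(cmod ?s)\<^sup>2 = real n * exp ((cmod z)\<^sup>2)" by (simp only: of_real_eq_iff)
  have dist: "(cmod (w - z))\<^sup>2 = (cmod w)\<^sup>2 + (cmod z)\<^sup>2 - 2 * Re (w * cnj z)"
    unfolding cmod_power2 by (simp add: power2_eq_square algebra_simps)
  have "exp (- (cmod (w - z))\<^sup>2) = exp (- (cmod w)\<^sup>2) * (exp (Re (w * cnj z)))\<^sup>2 / exp ((cmod z)\<^sup>2)"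
  proof -
    have "- (cmod (w - z))\<^sup>2 = - (cmod w)\<^sup>2 + (Re (w * cnj z) + Re (w * cnj z)) - (cmod z)\<^sup>2"
      unfolding dist by simp
    then show ?thesis by (simp only: exp_diff exp_add power2_eq_square)
  qed
  moreover have "(cmod (normalized_kernel n z w))\<^sup>2
      = (laguerre 1 (n - 1) ((cmod (w - z))\<^sup>2))\<^sup>2 * (exp (Re (w * cnj z)))\<^sup>2 / (real n * exp ((cmod z)\<^sup>2))"
    unfolding normalized_kernel_def norm_divide power_divide s
    by (simp add: fock_kernel_def norm_mult power_mult_distrib)
  ultimately show ?thesis by (simp add: berezin_density_def mult_ac)
qed

lemma berezin_density_borel [measurable]: "berezin_density n \<in> borel_measurable borel"
  unfolding berezin_density_def laguerre_def by measurable

lemma berezin_eq_convolution: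
  assumes "n \<ge> 1" and f: "f \<in> borel_measurable lebesgue"
  shows "berezin n f z = (LINT w|lebesgue. f w * of_real (berezin_density n (w - z)))"
proof -
  let ?k = "normalized_kernel n z"
  have "?k \<in> borel_measurable borel"
    unfolding normalized_kernel_def fock_kernel_def laguerre_def by measurable
  then have k: "?k \<in> borel_measurable lebesgue" by (simp add: measurable_completion)
  have "berezin n f z = (LINT w|lebesgue. (exp (- (cmod w)\<^sup>2) / pi) *\<^sub>R (f w * ?k w * cnj (?k w)))"
    unfolding berezin_def gauss_inner_def gauss_def
  proof (rule integral_density)
    show "(\<lambda>w. f w * ?k w * cnj (?k w)) \<in> borel_measurable lebesgue"
      using f k by (intro borel_measurable_times measurable_compose[OF k borel_measurable_continuous_onI])
        (auto intro: continuous_intros)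
    show "(\<lambda>w. exp (- (cmod w)\<^sup>2) / pi) \<in> borel_measurable lebesgue"
      by (intro measurable_completion) simp
  qed simp
  also have "\<dots> = (LINT w|lebesgue. f w * of_real (berezin_density n (w - z)))"
  proof (intro Bochner_Integration.integral_cong refl)
    fix w
    show "(exp (- (cmod w)\<^sup>2) / pi) *\<^sub>R (f w * ?k w * cnj (?k w)) = f w * of_real (berezin_density n (w - z))"
      unfolding normalized_kernel_density[OF assms(1), symmetric] of_real_mult complex_norm_square
      by (simp add: scaleR_conv_of_real mult_ac)
  qed
  finally show ?thesis .
qed

lemma berezin_density_shift:
  assumes "n \<ge> 1"
  shows "integrable lborel (\<lambda>w. berezin_density n (w - z))"
    and "(LINT w|lborel. berezin_density n (w - z)) = 1"
  using lborel_translation[OF berezin_density_borel, of n "- z"] berezin_density_integral[OF assms]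
  by (simp_all add: has_bochner_integral_iff)

lemma berezin_fixed_AE_constant:
  assumes n: "n \<ge> 1" and f: "f \<in> L_infty" and fixed: "AE z in lebesgue. berezin n f z = f z"
  shows "\<exists>c. AE z in lebesgue. f z = c"
proof -
  have fm: "f \<in> borel_measurable lebesgue" using f by (simp add: L_infty_def)
  obtain C where C: "AE z in lborel. cmod (f z) \<le> C" using f by (auto simp: L_infty_def AE_completion_iff)
  \<comment> \<open>The convolution theorem concerns real Borel functions, so \<open>T\<close>
    stands for \<open>Re\<close> or \<open>Im\<close>, and the Lebesgue measurable
    \<open>T (f z)\<close> is then replaced by a Borel representative \<open>g\<close>.\<close>
  have "\<exists>c. AE z in lborel. T (f z) = c" if T: "bounded_linear T" "\<And>z. \<bar>T z\<bar> \<le> cmod z" for T :: "complex \<Rightarrow> real"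
  proof -
    interpret T: bounded_linear T by fact
    have "(\<lambda>z. T (f z)) \<in> borel_measurable lebesgue"
      using fm T.continuous_on[OF continuous_on_id] by (intro measurable_compose[OF fm] borel_measurable_continuous_onI) simp
    then obtain g where g [measurable]: "g \<in> borel_measurable borel" and eq: "AE z in lborel. T (f z) = g z"
      using completion_ex_borel_measurable_real[of "\<lambda>z. T (f z)" lborel] by auto
    have bnd: "AE z in lborel. \<bar>g z\<bar> \<le> C"
      using C eq by eventually_elim (use T(2) in \<open>metis order_trans\<close>)
    have conv: "T (berezin n f z) = (LINT w|lborel. g w * berezin_density n (w - z))" for z
    proof -
      let ?p = "\<lambda>w. berezin_density n (w - z)"
      have pm: "?p \<in> borel_measurable lebesgue" by (intro measurable_completion) simp
      have "integrable lebesgue (\<lambda>w. of_real (?p w) * f w)"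
      proof (rule Bochner_Integration.integrable_bound)
        show "integrable lebesgue (\<lambda>w. C * ?p w)"
          using berezin_density_shift(1)[OF n, of z] by (simp add: integrable_completion)
        show "(\<lambda>w. of_real (?p w) * f w) \<in> borel_measurable lebesgue"
          using pm fm by (intro borel_measurable_times) (auto intro: measurable_compose[OF pm])
        have "AE w in lebesgue. cmod (f w) \<le> C" using C by (rule AE_completion)
        then show "AE w in lebesgue. norm (of_real (?p w) * f w) \<le> norm (C * ?p w)"
          proof eventually_elim
            case (elim w)
            have "norm (of_real (?p w) * f w) = cmod (f w) * ?p w"
              by (simp add: norm_mult berezin_density_nonneg)
            also have "\<dots> \<le> C * ?p w"
              using elim by (intro mult_right_mono berezin_density_nonneg)
            finally show ?case by simp
          qed
      qed
      then have "T (berezin n f z) = (LINT w|lebesgue. T (of_real (?p w) * f w))"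
        unfolding berezin_eq_convolution[OF n fm] by (simp add: integral_bounded_linear[OF T(1)] mult.commute)
      also have "\<dots> = (LINT w|lebesgue. g w * ?p w)"
      proof (rule integral_cong_AE)
        show "(\<lambda>w. T (of_real (?p w) * f w)) \<in> borel_measurable lebesgue"
          using \<open>(\<lambda>z. T (f z)) \<in> _\<close> pm by (simp add: T.scaleR scaleR_conv_of_real[symmetric])
        show "(\<lambda>w. g w * ?p w) \<in> borel_measurable lebesgue" by (intro measurable_completion) simp
        show "AE w in lebesgue. T (of_real (?p w) * f w) = g w * ?p w"
          using AE_completion[OF eq] by eventually_elim (simp add: T.scaleR scaleR_conv_of_real[symmetric])
      qed
      also have "\<dots> = (LINT w|lborel. g w * ?p w)" by (rule integral_completion) simp
      finally show ?thesis .
    qed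
    have "AE z in lborel. berezin n f z = f z" using fixed by (simp add: AE_completion_iff)
    then have "AE z in lborel. (LINT w|lborel. g w * berezin_density n (w - z)) = g z"
      using eq by eventually_elim (metis conv)
    then obtain c where "AE z in lborel. g z = c"
      using average_fixed_AE_constant[OF _ _ berezin_density_nonneg berezin_density_pos_AE[OF n] g bnd]
        berezin_density_integral[OF n] by (auto simp: has_bochner_integral_iff)
    with eq have "AE z in lborel. T (f z) = c" by eventually_elim simp
    then show ?thesis ..
  qed
  from this[OF bounded_linear_Re] this[OF bounded_linear_Im] obtain a b
    where "AE z in lborel. Re (f z) = a" "AE z in lborel. Im (f z) = b"
    by (auto simp: abs_Re_le_cmod abs_Im_le_cmod)
  then have "AE z in lborel. f z = Complex a b" by eventually_elim (simp add: complex_eq_iff)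
  then show ?thesis by (blast intro: AE_completion)
qed

text \<open>The value is exact at every \<open>z\<close>: the integral ignores null sets and each
  translated density has mass 1.\<close>

lemma berezin_AE_constant:
  assumes n: "n \<ge> 1" and fm: "f \<in> borel_measurable lebesgue" and c: "AE z in lebesgue. f z = c"
  shows "berezin n f z = c"
proof -
  let ?p = "\<lambda>w. berezin_density n (w - z)"
  have pm: "(\<lambda>w. complex_of_real (?p w)) \<in> borel_measurable lebesgue" by (intro measurable_completion) simp
  have "berezin n f z = (LINT w|lebesgue. c * of_real (?p w))"
    unfolding berezin_eq_convolution[OF n fm]
  proof (rule integral_cong_AE)
    show "AE w in lebesgue. f w * of_real (?p w) = c * of_real (?p w)"
      using c by eventually_elim simp
  qed (use fm pm in auto)
  also have "\<dots> = (LINT w|lborel. c * of_real (?p w))" by (rule integral_completion) simp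
  also have "\<dots> = c" using berezin_density_shift[OF n, of z] by simp
  finally show ?thesis .
qed

text \<open>The essential bound on \<open>f\<close> passes to \<open>h\<close>, and by continuity of
  \<open>h\<close> it holds at every point, so the Liouville property applies.\<close>

lemma AE_harmonic_constant:
  assumes f: "f \<in> L_infty" and h: "h harmonic_on UNIV" and eq: "AE z in lebesgue. f z = h z"
  shows "AE z in lebesgue. f z = h 0"
proof -
  obtain C where "AE z in lebesgue. cmod (f z) \<le> C" using f by (auto simp: L_infty_def)
  with eq have "AE z in lebesgue. cmod (h z) \<le> C" by eventually_elim simp
  moreover have "continuous_on UNIV h"
    using h by (auto simp: harmonic_on_def C2_on_def C1_on_def intro: differentiable_imp_continuous_on)
  ultimately have "cmod (h z) \<le> C" for z by (intro AE_bounded_continuous)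
  then have const: "h z = h 0" for z by (rule bounded_harmonic_constant[OF h])
  show ?thesis using eq by eventually_elim (metis const)
qed

theorem corollary2:
  fixes n :: nat and f :: "complex \<Rightarrow> complex"
  assumes "n \<ge> 1"
    and "f \<in> L_infty"
  shows "((AE z in lebesgue. berezin n f z = f z) \<longleftrightarrow>
            (\<exists>h. h harmonic_on UNIV \<and> (AE z in lebesgue. f z = h z)))
       \<and> ((\<exists>h. h harmonic_on UNIV \<and> (AE z in lebesgue. f z = h z)) \<longleftrightarrow>
            (\<exists>c. AE z in lebesgue. f z = c))"
proof -
  \<comment> \<open>Constancy is the hub: each of the other two conditions is shown to imply it and
    to follow from it.\<close>
  have "\<exists>c. AE z in lebesgue. f z = c" if "AE z in lebesgue. berezin n f z = f z"
    using berezin_fixed_AE_constant assms that by blast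
  moreover have "\<exists>h. h harmonic_on UNIV \<and> (AE z in lebesgue. f z = h z)" if "\<exists>c. AE z in lebesgue. f z = c"
    using that constant_harmonic by blast
  moreover have "\<exists>c. AE z in lebesgue. f z = c" if "\<exists>h. h harmonic_on UNIV \<and> (AE z in lebesgue. f z = h z)"
    using that AE_harmonic_constant assms(2) by blast
  moreover have "AE z in lebesgue. berezin n f z = f z" if c: "AE z in lebesgue. f z = c" for c
    using c by eventually_elim (use berezin_AE_constant[OF assms(1) _ c] assms(2) in \<open>simp add: L_infty_def\<close>)
  ultimately show ?thesis by blast
qed

end
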